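(* Let $R$ be an arbitrary unital associative and commutative ring such that $\frac{1}{3} \in R$. Let $A$ be a unital associative algebra over $R$. Let $n \in \mathbb{Z}$, $n > 2$. Then the two-sided ideal of $A$ generated by the set $[T^{(n-2)}, A, A]$ coincides with $T^{(n)}$, that is, \[ A\,[T^{(n-2)}, A, A]\,A = T^{(n)} . \]
   Context: $\frac13\in R$ means that $3=1+1+1$ is invertible in $R$. Commutators are additive and left-normed: $[a_1,a_2] = a_1a_2 - a_2a_1$ and $[a_1, \dots, a_{m-1}, a_m] = \bigl[[a_1,\dots,a_{m-1}],a_m\bigr]$ for $m>2$. For $m \ge 2$, $T^{(m)} = T^{(m)}(A)$ is the two-sided ideal of $A$ generated by all commutators $[a_1, \dots, a_m]$ with $a_i \in A$; and $T^{(1)} = A$. $[T^{(n-2)}, A, A]$ denotes the $R$-linear span of all commutators $[u,a_1,a_2]$ with $u \in T^{(n-2)}$, $a_1,a_2 \in A$, and $A\,[T^{(n-2)}, A, A]\,A$ is the two-sided ideal of $A$ generated by it. *)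

theory Defs
  imports "HOL-Algebra.Algebra"
begin

(* The library locale algebra requires a commutative multiplication on the algebra; here the
   algebra is only an associative unital ring. *)
locale assoc_algebra = R?: cring R + module R A + A?: ring A
  for R :: "('r, 'x) ring_scheme" and A :: "('r, 'a, 'y) module_scheme" +
  assumes smult_mult_left:
      "\<lbrakk>r \<in> carrier R; x \<in> carrier A; y \<in> carrier A\<rbrakk> \<Longrightarrow>
        (r \<odot>\<^bsub>A\<^esub> x) \<otimes>\<^bsub>A\<^esub> y = r \<odot>\<^bsub>A\<^esub> (x \<otimes>\<^bsub>A\<^esub> y)"
    and smult_mult_right:
      "\<lbrakk>r \<in> carrier R; x \<in> carrier A; y \<in> carrier A\<rbrakk> \<Longrightarrow>
        x \<otimes>\<^bsub>A\<^esub> (r \<odot>\<^bsub>A\<^esub> y) = r \<odot>\<^bsub>A\<^esub> (x \<otimes>\<^bsub>A\<^esub> y)"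

definition comm :: "('a, 'y) ring_scheme \<Rightarrow> 'a \<Rightarrow> 'a \<Rightarrow> 'a"
  where "comm A x y = (x \<otimes>\<^bsub>A\<^esub> y) \<ominus>\<^bsub>A\<^esub> (y \<otimes>\<^bsub>A\<^esub> x)"

(* left_comm A [a1, ..., am] is the left-normed commutator [[...[a1, a2], ...], am].
   Only used for lists of length at least 2. *)
definition left_comm :: "('a, 'y) ring_scheme \<Rightarrow> 'a list \<Rightarrow> 'a"
  where "left_comm A xs = foldl (comm A) (hd xs) (tl xs)"

(* T_ideal A m is T^(m); the value at m = 0 is a convention without significance. *)
definition T_ideal :: "('a, 'y) ring_scheme \<Rightarrow> nat \<Rightarrow> 'a set"
  where "T_ideal A m =
    (if m \<le> 1 then carrier A
     else Idl\<^bsub>A\<^esub> {left_comm A xs | xs. length xs = m \<and> set xs \<subseteq> carrier A})"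

(* The linear span as the least submodule containing S; the library's Span is over subfields. *)
definition lin_span :: "('r, 'x) ring_scheme \<Rightarrow> ('r, 'a, 'y) module_scheme \<Rightarrow> 'a set \<Rightarrow> 'a set"
  where "lin_span R A S = \<Inter>{N. submodule N R A \<and> S \<subseteq> N}"

(* [U, A, A] *)
definition comm_span :: "('r, 'x) ring_scheme \<Rightarrow> ('r, 'a, 'y) module_scheme \<Rightarrow> 'a set \<Rightarrow> 'a set"
  where "comm_span R A U =
    lin_span R A {left_comm A [u, a, b] | u a b. u \<in> U \<and> a \<in> carrier A \<and> b \<in> carrier A}"

end

theory Submission
  imports Defs
begin

text \<open>
  Write \<open>T m\<close> for the ideal \<open>T_ideal A m\<close>. A left-normed commutator of length \<open>n\<close> is \<open>[[u, a], b]\<close>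
  with \<open>u\<close> its initial part of length \<open>n - 2\<close>, so \<open>T n\<close> is contained in the ideal generated by
  \<open>[T (n - 2), A, A]\<close>. The content of the theorem is the converse, \<open>[[u, a], b] \<in> T n\<close> for all
  \<open>u \<in> T (n - 2)\<close>. It is immediate for \<open>n = 3\<close>. For \<open>n > 3\<close> it suffices to treat \<open>u = x e y\<close> with
  \<open>e = [c, z]\<close> a commutator of length \<open>n - 2\<close>, and since \<open>x e = e x - [e, x]\<close> even \<open>u = e y\<close>: with
  its first two entries read as one, \<open>[e, x]\<close> is again a commutator of length \<open>n - 2\<close>.

  Compute modulo \<open>T n\<close>, where \<open>[[[c, z], a], b] = 0\<close> for all \<open>z\<close>, \<open>a\<close>, \<open>b\<close>. Then \<open>[e, a]\<close> is central,
  and the Leibniz rule gives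
  \<open>[[e y, a], b] = e [[y, a], b] + ([e, a] [y, b] + [e, b] [y, a])\<close>.
  The bracketed sum vanishes, as one sees by expanding \<open>[[e, a b], d] = 0\<close>
  (\<open>comm_mult_comm_antisym\<close>). There remains
  \<open>g(z, y, a, b) = [c, z] [[y, a], b]\<close>. Expanding \<open>[[[c, z y], a], b] = 0\<close> shows that \<open>g\<close> changes its
  sign when \<open>z\<close> and \<open>y\<close> are exchanged (\<open>comm_mult_triple_comm_antisym\<close>); it also changes its sign
  when \<open>y\<close> and \<open>a\<close> are, and satisfies the Jacobi identity in \<open>y\<close>, \<open>a\<close>, \<open>b\<close>. These symmetries alone
  force \<open>3 g = 0\<close> (\<open>three_alternating_jacobi\<close>), and \<open>3\<close> is invertible.
\<close>

section \<open>Commutator identities\<close>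

context ring
begin

lemma comm_closed [simp, intro]:
  "\<lbrakk>x \<in> carrier R; y \<in> carrier R\<rbrakk> \<Longrightarrow> comm R x y \<in> carrier R"
  by (simp add: comm_def)

lemma comm_add_left:
  assumes "x \<in> carrier R" "y \<in> carrier R" "z \<in> carrier R"
  shows "comm R (x \<oplus> y) z = comm R x z \<oplus> comm R y z"
  using assms unfolding comm_def by algebra

lemma comm_minus_left:
  assumes "x \<in> carrier R" "y \<in> carrier R"
  shows "comm R (\<ominus> x) y = \<ominus> comm R x y"
  using assms unfolding comm_def by algebra

lemma comm_swap:
  assumes "x \<in> carrier R" "y \<in> carrier R"
  shows "comm R x y = \<ominus> comm R y x"
  using assms unfolding comm_def by algebra

lemma comm_zero_left [simp]: "x \<in> carrier R \<Longrightarrow> comm R \<zero> x = \<zero>"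
  by (simp add: comm_def r_right_minus_eq)

lemma comm_mult_left:
  assumes "x \<in> carrier R" "y \<in> carrier R" "z \<in> carrier R"
  shows "comm R (x \<otimes> y) z = x \<otimes> comm R y z \<oplus> comm R x z \<otimes> y"
  using assms unfolding comm_def by algebra

lemma comm_mult_right:
  assumes "x \<in> carrier R" "y \<in> carrier R" "z \<in> carrier R"
  shows "comm R x (y \<otimes> z) = y \<otimes> comm R x z \<oplus> comm R x y \<otimes> z"
  using assms unfolding comm_def by algebra

lemma comm_jacobi:
  assumes "x \<in> carrier R" "y \<in> carrier R" "z \<in> carrier R"
  shows "comm R (comm R x y) z \<oplus> comm R (comm R y z) x \<oplus> comm R (comm R z x) y = \<zero>"
  using assms unfolding comm_def by algebra

lemma comm_eq_zero_iff:
  assumes "x \<in> carrier R" "y \<in> carrier R"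
  shows "comm R x y = \<zero> \<longleftrightarrow> x \<otimes> y = y \<otimes> x"
  using assms by (simp add: comm_def r_right_minus_eq)

lemma comm_mult_left_twice:
  assumes [simp]: "x \<in> carrier R" "y \<in> carrier R" "a \<in> carrier R" "b \<in> carrier R"
  shows "comm R (comm R (x \<otimes> y) a) b =
    (x \<otimes> comm R (comm R y a) b \<oplus> comm R (comm R x a) b \<otimes> y)
    \<oplus> (comm R x a \<otimes> comm R y b \<oplus> comm R x b \<otimes> comm R y a)"
  by (simp add: comm_mult_left comm_add_left a_ac)

lemma comm_comm_right:
  assumes [simp]: "c \<in> carrier R" "x \<in> carrier R" "y \<in> carrier R"
  shows "comm R c (comm R x y) = comm R (comm R c x) y \<ominus> comm R (comm R c y) x"
  using assms unfolding comm_def by algebra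

section \<open>Rings in which long commutators of a given element vanish\<close>

text \<open>If all \<open>[c, x]\<close> are central, expanding \<open>[[c, a b], d] = 0\<close> leaves exactly these two terms.\<close>
lemma comm_mult_comm_antisym:
  assumes [simp]: "c \<in> carrier R" "a \<in> carrier R" "b \<in> carrier R" "d \<in> carrier R"
    and c: "\<And>x y. \<lbrakk>x \<in> carrier R; y \<in> carrier R\<rbrakk> \<Longrightarrow> comm R (comm R c x) y = \<zero>"
  shows "comm R c a \<otimes> comm R b d \<oplus> comm R c b \<otimes> comm R a d = \<zero>"
proof -
  have central: "x \<otimes> comm R c b = comm R c b \<otimes> x" if "x \<in> carrier R" for x
    using c[of b x] that by (simp add: comm_eq_zero_iff)
  have "\<zero> = comm R (comm R c (a \<otimes> b)) d"
    by (simp add: c)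
  also have "\<dots> = comm R c a \<otimes> comm R b d \<oplus> comm R c b \<otimes> comm R a d"
    by (simp add: comm_mult_right comm_add_left comm_mult_left c central a_ac)
  finally show ?thesis by simp
qed

text \<open>Elements with central commutators behave like scalars under \<open>[[_, a], b]\<close>. The cross terms of
  the Leibniz expansion cancel by \<open>comm_mult_comm_antisym\<close>, and \<open>c\<close> commutes with
  \<open>[[y, a], b]\<close> because \<open>[c, [u, v]] = [[c, u], v] - [[c, v], u] = 0\<close>.\<close>
lemma
  assumes [simp]: "c \<in> carrier R" "y \<in> carrier R" "a \<in> carrier R" "b \<in> carrier R"
    and c: "\<And>x y. \<lbrakk>x \<in> carrier R; y \<in> carrier R\<rbrakk> \<Longrightarrow> comm R (comm R c x) y = \<zero>"
  shows comm_comm_mult_left: "comm R (comm R (c \<otimes> y) a) b = c \<otimes> comm R (comm R y a) b"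
    and comm_comm_mult_right: "comm R (comm R (y \<otimes> c) a) b = c \<otimes> comm R (comm R y a) b"
proof -
  have central: "x \<otimes> comm R c z = comm R c z \<otimes> x"
    if "x \<in> carrier R" "z \<in> carrier R" for x z
    using c[of z x] that by (simp add: comm_eq_zero_iff)
  have commutes: "comm R (comm R y a) b \<otimes> c = c \<otimes> comm R (comm R y a) b"
  proof -
    have "comm R c (comm R (comm R y a) b) = \<zero>"
      by (simp add: comm_comm_right[of c "comm R y a" b] c r_right_minus_eq)
    then show ?thesis by (simp add: comm_eq_zero_iff)
  qed
  have "comm R c a \<otimes> comm R y b \<oplus> comm R c b \<otimes> comm R y a
      = \<ominus> (comm R c a \<otimes> comm R b y \<oplus> comm R c b \<otimes> comm R a y)"
    by (simp add: comm_swap[of y] r_minus minus_add)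
  also have "\<dots> = \<zero>"
    by (subst comm_mult_comm_antisym) (simp_all add: c)
  finally have cross: "comm R c a \<otimes> comm R y b \<oplus> comm R c b \<otimes> comm R y a = \<zero>" .
  show "comm R (comm R (c \<otimes> y) a) b = c \<otimes> comm R (comm R y a) b"
    by (simp add: comm_mult_left_twice c cross)
  have cross': "comm R y a \<otimes> comm R c b \<oplus> comm R y b \<otimes> comm R c a = \<zero>"
    using cross by (simp add: central a_comm)
  show "comm R (comm R (y \<otimes> c) a) b = c \<otimes> comm R (comm R y a) b"
    by (simp add: comm_mult_left_twice c cross' commutes)
qed

text \<open>Both terms come out of expanding \<open>[[[c, z y], a], b] = 0\<close> by
  \<open>[c, z y] = z [c, y] + [c, z] y\<close>: the factors \<open>[c, y]\<close> and \<open>[c, z]\<close> have only central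
  commutators, so they can be pulled out of the double commutator.\<close>
lemma comm_mult_triple_comm_antisym:
  assumes [simp]: "c \<in> carrier R" "z \<in> carrier R" "y \<in> carrier R" "a \<in> carrier R" "b \<in> carrier R"
    and c: "\<And>x y z. \<lbrakk>x \<in> carrier R; y \<in> carrier R; z \<in> carrier R\<rbrakk>
      \<Longrightarrow> comm R (comm R (comm R c x) y) z = \<zero>"
  shows "comm R c z \<otimes> comm R (comm R y a) b = \<ominus> (comm R c y \<otimes> comm R (comm R z a) b)"
proof -
  have "\<zero> = comm R (comm R (comm R c (z \<otimes> y)) a) b"
    by (simp add: c)
  also have "\<dots> = comm R (comm R (z \<otimes> comm R c y) a) b
      \<oplus> comm R (comm R (comm R c z \<otimes> y) a) b"
    by (simp add: comm_mult_right comm_add_left)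
  also have "\<dots> = comm R c y \<otimes> comm R (comm R z a) b \<oplus> comm R c z \<otimes> comm R (comm R y a) b"
    by (simp add: comm_comm_mult_left comm_comm_mult_right c)
  finally show ?thesis
    using minus_equality[of "comm R c z \<otimes> comm R (comm R y a) b" "comm R c y \<otimes> comm R (comm R z a) b"]
    by (simp add: a_comm)
qed

text \<open>Subtract the Jacobi identities with \<open>p\<close> and with \<open>q\<close> in the first place: by antisymmetry in the
  first three arguments, two terms of the one equal two of the other, and what is left is
  antisymmetry in the outer two arguments. So \<open>g\<close> changes its sign under every transposition; the
  three terms of the Jacobi identity are then related by even permutations, hence equal, and their
  sum is three times each of them.\<close>
lemma three_alternating_jacobi:
  assumes closed: "\<And>w x y z. \<lbrakk>w \<in> carrier R; x \<in> carrier R; y \<in> carrier R; z \<in> carrier R\<rbrakk>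
      \<Longrightarrow> g w x y z \<in> carrier R"
    and swap12: "\<And>w x y z. \<lbrakk>w \<in> carrier R; x \<in> carrier R; y \<in> carrier R; z \<in> carrier R\<rbrakk>
      \<Longrightarrow> g w x y z = \<ominus> g x w y z"
    and swap23: "\<And>w x y z. \<lbrakk>w \<in> carrier R; x \<in> carrier R; y \<in> carrier R; z \<in> carrier R\<rbrakk>
      \<Longrightarrow> g w x y z = \<ominus> g w y x z"
    and jacobi: "\<And>w x y z. \<lbrakk>w \<in> carrier R; x \<in> carrier R; y \<in> carrier R; z \<in> carrier R\<rbrakk>
      \<Longrightarrow> g w x y z \<oplus> g w y z x \<oplus> g w z x y = \<zero>"
    and [simp]: "w \<in> carrier R" "x \<in> carrier R" "y \<in> carrier R" "z \<in> carrier R"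
  shows "g w x y z \<oplus> g w x y z \<oplus> g w x y z = \<zero>"
proof -
  note [simp] = closed
  have cyc: "g p q r s = g q r p s"
    if [simp]: "p \<in> carrier R" "q \<in> carrier R" "r \<in> carrier R" "s \<in> carrier R" for p q r s
    using swap12[of p q r s] swap23[of q p r s] by simp
  have swap14: "g p r s q = \<ominus> g q r s p"
    if [simp]: "p \<in> carrier R" "q \<in> carrier R" "r \<in> carrier R" "s \<in> carrier R" for p q r s
  proof -
    have eqs: "g q p s r = g p s q r" "g q r p s = g p q r s"
      using swap12[of q p s r] swap23[of p q s r] cyc[of p q r s] by simp_all
    have "g q s r p \<oplus> (g p q r s \<oplus> g p s q r) = g p r s q \<oplus> (g p q r s \<oplus> g p s q r)"
      using jacobi[of p q r s] jacobi[of q p s r] by (simp add: eqs a_ac)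
    then have "g p r s q = g q s r p"
      by (subst (asm) add.right_cancel) simp_all
    then show ?thesis
      using swap23[of q s r p] by simp
  qed
  have "g w y z x = g w x y z"
    using swap14[of w x y z] swap14[of w z x y] cyc[of z x y w] by simp
  moreover have "g w z x y = g w x y z"
    using swap14[of w y z x] swap14[of w z x y] cyc[of y z x w] by simp
  ultimately show ?thesis
    using jacobi[of w x y z] by simp
qed

text \<open>A case of the inclusion \<open>T m T 3 \<subseteq> T (m + 2)\<close>, read modulo the ideal on the right:
  the product is alternating in \<open>z\<close>, \<open>y\<close>, \<open>a\<close> and satisfies the Jacobi identity in \<open>y\<close>, \<open>a\<close>, \<open>b\<close>,
  so three times it vanishes.\<close>
lemma comm_mult_triple_comm_zero:
  assumes [simp]: "c \<in> carrier R" "z \<in> carrier R" "y \<in> carrier R" "a \<in> carrier R" "b \<in> carrier R"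
    and c: "\<And>x y z. \<lbrakk>x \<in> carrier R; y \<in> carrier R; z \<in> carrier R\<rbrakk>
      \<Longrightarrow> comm R (comm R (comm R c x) y) z = \<zero>"
    and three: "\<And>x. \<lbrakk>x \<in> carrier R; x \<oplus> x \<oplus> x = \<zero>\<rbrakk> \<Longrightarrow> x = \<zero>"
  shows "comm R c z \<otimes> comm R (comm R y a) b = \<zero>"
proof (rule three)
  show "comm R c z \<otimes> comm R (comm R y a) b \<oplus> comm R c z \<otimes> comm R (comm R y a) b
      \<oplus> comm R c z \<otimes> comm R (comm R y a) b = \<zero>"
  proof (rule three_alternating_jacobi[where g = "\<lambda>z y a b. comm R c z \<otimes> comm R (comm R y a) b"])
    fix w x y z
    assume [simp]: "w \<in> carrier R" "x \<in> carrier R" "y \<in> carrier R" "z \<in> carrier R"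
    show "comm R c w \<otimes> comm R (comm R x y) z \<in> carrier R" by simp
    show "comm R c w \<otimes> comm R (comm R x y) z = \<ominus> (comm R c x \<otimes> comm R (comm R w y) z)"
      by (rule comm_mult_triple_comm_antisym) (simp_all add: c)
    show "comm R c w \<otimes> comm R (comm R x y) z = \<ominus> (comm R c w \<otimes> comm R (comm R y x) z)"
      by (simp add: comm_swap[of x y] comm_minus_left r_minus)
    show "comm R c w \<otimes> comm R (comm R x y) z \<oplus> comm R c w \<otimes> comm R (comm R y z) x
        \<oplus> comm R c w \<otimes> comm R (comm R z x) y = \<zero>"
      by (simp add: r_distr[symmetric] comm_jacobi)
  qed simp_all
qed simp

lemma comm_mult_comm_twice_zero:
  assumes [simp]: "c \<in> carrier R" "z \<in> carrier R" "y \<in> carrier R" "a \<in> carrier R" "b \<in> carrier R"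
    and c: "\<And>x y z. \<lbrakk>x \<in> carrier R; y \<in> carrier R; z \<in> carrier R\<rbrakk>
      \<Longrightarrow> comm R (comm R (comm R c x) y) z = \<zero>"
    and three: "\<And>x. \<lbrakk>x \<in> carrier R; x \<oplus> x \<oplus> x = \<zero>\<rbrakk> \<Longrightarrow> x = \<zero>"
  shows "comm R (comm R (comm R c z \<otimes> y) a) b = \<zero>"
  by (simp add: comm_comm_mult_left c comm_mult_triple_comm_zero[OF _ _ _ _ _ c three])

text \<open>The left factor is moved to the right by \<open>x e = e x - [e, x]\<close> with \<open>e = [c, z]\<close>. The
  correction \<open>[e, x]\<close> is again of the form \<open>[c', z']\<close>, now with \<open>c' = [c, z]\<close>, which inherits the
  hypothesis on \<open>c\<close>.\<close>
lemma sandwich_comm_twice_zero: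
  assumes [simp]: "c \<in> carrier R" "z \<in> carrier R" "x \<in> carrier R" "y \<in> carrier R"
      "a \<in> carrier R" "b \<in> carrier R"
    and c: "\<And>x y z. \<lbrakk>x \<in> carrier R; y \<in> carrier R; z \<in> carrier R\<rbrakk>
      \<Longrightarrow> comm R (comm R (comm R c x) y) z = \<zero>"
    and three: "\<And>x. \<lbrakk>x \<in> carrier R; x \<oplus> x \<oplus> x = \<zero>\<rbrakk> \<Longrightarrow> x = \<zero>"
  shows "comm R (comm R (x \<otimes> comm R c z \<otimes> y) a) b = \<zero>"
proof -
  have "x \<otimes> e \<otimes> y = e \<otimes> (x \<otimes> y) \<oplus> \<ominus> (comm R e x \<otimes> y)" if [simp]: "e \<in> carrier R" for e
    by (simp add: comm_def minus_eq l_distr l_minus minus_add m_assoc r_neg2)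
  then have "x \<otimes> comm R c z \<otimes> y = comm R c z \<otimes> (x \<otimes> y) \<oplus> \<ominus> (comm R (comm R c z) x \<otimes> y)"
    by simp
  moreover have "comm R (comm R (comm R c z \<otimes> (x \<otimes> y)) a) b = \<zero>"
    by (rule comm_mult_comm_twice_zero[OF _ _ _ _ _ c three]) simp_all
  moreover have "comm R (comm R (comm R (comm R c z) x \<otimes> y) a) b = \<zero>"
    by (rule comm_mult_comm_twice_zero[OF _ _ _ _ _ _ three]) (simp_all add: c)
  ultimately show ?thesis
    by (simp add: comm_add_left comm_minus_left)
qed

section \<open>The ideals of long commutators\<close>

lemma left_comm_closed:
  assumes "set xs \<subseteq> carrier R" "xs \<noteq> []"
  shows "left_comm R xs \<in> carrier R"
  using assms
proof (induction xs rule: rev_induct)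
  case (snoc x xs)
  then show ?case by (cases xs) (auto simp: left_comm_def)
qed simp

lemma left_comm_snoc:
  "xs \<noteq> [] \<Longrightarrow> left_comm R (xs @ [x]) = comm R (left_comm R xs) x"
  by (cases xs) (simp_all add: left_comm_def)

lemma T_ideal_is_ideal: "ideal (T_ideal R m) R"
proof (cases "m \<le> 1")
  case True
  then show ?thesis by (simp add: T_ideal_def oneideal)
next
  case False
  have "ideal (Idl {left_comm R xs | xs. length xs = m \<and> set xs \<subseteq> carrier R}) R"
    using False by (intro genideal_ideal) (auto intro!: left_comm_closed)
  then show ?thesis using False by (simp add: T_ideal_def)
qed

lemma left_comm_in_T_ideal:
  assumes "set xs \<subseteq> carrier R" "length xs = m" "m > 0"
  shows "left_comm R xs \<in> T_ideal R m"
proof (cases "m \<le> 1")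
  case True
  have "left_comm R xs \<in> carrier R" using assms by (intro left_comm_closed) auto
  then show ?thesis using True by (simp add: T_ideal_def)
next
  case False
  have "left_comm R xs \<in> Idl {left_comm R xs | xs. length xs = m \<and> set xs \<subseteq> carrier R}"
    using False assms by (intro subsetD[OF genideal_self]) (auto intro!: left_comm_closed)
  then show ?thesis using False by (simp add: T_ideal_def)
qed

lemma T_ideal_minimal:
  assumes "ideal J R" "m > 1"
    and "\<And>xs. \<lbrakk>length xs = m; set xs \<subseteq> carrier R\<rbrakk> \<Longrightarrow> left_comm R xs \<in> J"
  shows "T_ideal R m \<subseteq> J"
proof -
  have "Idl {left_comm R xs | xs. length xs = m \<and> set xs \<subseteq> carrier R} \<subseteq> J"
    using assms(3) by (intro genideal_minimal[OF assms(1)]) blast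
  then show ?thesis using assms(2) by (simp add: T_ideal_def)
qed

text \<open>The elements \<open>u\<close> with \<open>[[u, a], b] \<in> I\<close> do not form an ideal in general; with arbitrary factors
  on both sides of \<open>u\<close> they do, so that membership need only be tested on ideal generators.\<close>
lemma ideal_sandwich_comm_twice:
  assumes "ideal I R"
  shows "ideal {u \<in> carrier R. \<forall>x\<in>carrier R. \<forall>y\<in>carrier R. \<forall>a\<in>carrier R. \<forall>b\<in>carrier R.
    comm R (comm R (x \<otimes> u \<otimes> y) a) b \<in> I} R" (is "ideal ?J R")
proof -
  interpret I: ideal I R by fact
  show ?thesis
  proof (rule idealI)
    show "ring R" by (rule ring_axioms)
    show "subgroup ?J (add_monoid R)"
    proof (rule add.subgroupI)
      show "?J \<subseteq> carrier R" by blast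
      show "?J \<noteq> {}" by (auto intro!: exI[of _ \<zero>])
    next
      fix u assume "u \<in> ?J"
      then show "\<ominus> u \<in> ?J" by (simp add: l_minus r_minus comm_minus_left)
    next
      fix u v assume "u \<in> ?J" "v \<in> ?J"
      then show "u \<oplus> v \<in> ?J" by (simp add: l_distr r_distr comm_add_left)
    qed
  next
    fix u s assume u: "u \<in> ?J" and s: "s \<in> carrier R"
    have "comm R (comm R (x \<otimes> (s \<otimes> u) \<otimes> y) a) b \<in> I" "comm R (comm R (x \<otimes> (u \<otimes> s) \<otimes> y) a) b \<in> I"
      if xy: "x \<in> carrier R" "y \<in> carrier R" "a \<in> carrier R" "b \<in> carrier R" for x y a b
    proof -
      have "x \<otimes> (s \<otimes> u) \<otimes> y = (x \<otimes> s) \<otimes> u \<otimes> y" "x \<otimes> (u \<otimes> s) \<otimes> y = x \<otimes> u \<otimes> (s \<otimes> y)"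
        using u s xy by (simp_all add: m_assoc)
      then show "comm R (comm R (x \<otimes> (s \<otimes> u) \<otimes> y) a) b \<in> I"
          "comm R (comm R (x \<otimes> (u \<otimes> s) \<otimes> y) a) b \<in> I"
        using u s xy by simp_all
    qed
    then show "s \<otimes> u \<in> ?J" "u \<otimes> s \<in> ?J" using u s by simp_all
  qed
qed

text \<open>The quotient by \<open>T_ideal R (length zs + 2)\<close> is a ring in which, for the prefix \<open>ws\<close> of \<open>zs\<close>
  without its last entry, all \<open>[[[left_comm R ws, p], q], r]\<close> vanish: these lift to commutators of
  length \<open>length zs + 2\<close>. There the claim is \<open>sandwich_comm_twice_zero\<close>. The
  first hypothesis says that every quotient of the ring is free of 3-torsion, which is how an
  invertible 3 enters when no scalars are present.\<close>
lemma sandwich_left_comm_comm_twice: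
  assumes three: "\<And>x I. \<lbrakk>ideal I R; x \<in> carrier R; x \<oplus> x \<oplus> x \<in> I\<rbrakk> \<Longrightarrow> x \<in> I"
    and zs: "set zs \<subseteq> carrier R" "length zs \<ge> 2"
    and xy: "x \<in> carrier R" "y \<in> carrier R" "a \<in> carrier R" "b \<in> carrier R"
  shows "comm R (comm R (x \<otimes> left_comm R zs \<otimes> y) a) b \<in> T_ideal R (length zs + 2)"
proof -
  define I where "I = T_ideal R (length zs + 2)"
  interpret I: ideal I R unfolding I_def by (rule T_ideal_is_ideal)
  let ?Q = "R Quot I" and ?h = "(+>) I"
  interpret Q: ring ?Q by (rule I.quotient_is_ring)
  interpret h: ring_hom_ring R ?Q ?h by (rule I.rcos_ring_hom_ring)
  have comm_h: "?h (comm R u v) = comm ?Q (?h u) (?h v)" if "u \<in> carrier R" "v \<in> carrier R" for u v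
    using that by (simp add: comm_def minus_eq Q.minus_eq)
  have zero: "?h u = \<zero>\<^bsub>?Q\<^esub> \<longleftrightarrow> u \<in> I" if "u \<in> carrier R" for u
  proof -
    have "?h u = I \<longleftrightarrow> u \<in> I"
      using I.rcos_const_imp_mem[OF that] I.a_rcos_const by blast
    then show ?thesis by (simp only: FactRing_def ring.simps)
  qed
  have surj: "\<exists>u\<in>carrier R. v = ?h u" if "v \<in> carrier ?Q" for v
    using that unfolding FactRing_def A_RCOSETS_def' partial_object.simps by blast
  obtain ws z where zs_eq: "zs = ws @ [z]"
    using zs(2) by (cases zs rule: rev_cases) auto
  have "ws \<noteq> []" using zs(2) zs_eq by (cases ws) auto
  have ws: "set ws \<subseteq> carrier R" and z: "z \<in> carrier R" using zs(1) zs_eq by auto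
  have c: "left_comm R ws \<in> carrier R" using ws \<open>ws \<noteq> []\<close> by (rule left_comm_closed)
  have lc: "comm R (comm R (comm R (left_comm R ws) p) q) r \<in> I"
    if "p \<in> carrier R" "q \<in> carrier R" "r \<in> carrier R" for p q r
    using left_comm_in_T_ideal[of "ws @ [p] @ [q] @ [r]" "length zs + 2"] that ws \<open>ws \<noteq> []\<close>
    by (simp add: zs_eq left_comm_def I_def)
  have "comm ?Q (comm ?Q (?h x \<otimes>\<^bsub>?Q\<^esub> comm ?Q (?h (left_comm R ws)) (?h z) \<otimes>\<^bsub>?Q\<^esub> ?h y) (?h a)) (?h b)
      = \<zero>\<^bsub>?Q\<^esub>"
  proof (rule Q.sandwich_comm_twice_zero)
    fix p q r assume "p \<in> carrier ?Q" "q \<in> carrier ?Q" "r \<in> carrier ?Q"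
    then obtain p' q' r' where "p' \<in> carrier R" "q' \<in> carrier R" "r' \<in> carrier R"
      and "p = ?h p'" "q = ?h q'" "r = ?h r'" by (metis surj)
    then show "comm ?Q (comm ?Q (comm ?Q (?h (left_comm R ws)) p) q) r = \<zero>\<^bsub>?Q\<^esub>"
      using lc[of p' q' r'] c by (simp add: comm_h[symmetric] zero)
  next
    fix p assume "p \<in> carrier ?Q" and p3: "p \<oplus>\<^bsub>?Q\<^esub> p \<oplus>\<^bsub>?Q\<^esub> p = \<zero>\<^bsub>?Q\<^esub>"
    then obtain p' where p': "p' \<in> carrier R" "p = ?h p'" using surj by blast
    then have "?h (p' \<oplus> p' \<oplus> p') = \<zero>\<^bsub>?Q\<^esub>" using p3 by simp
    then have "p' \<oplus> p' \<oplus> p' \<in> I"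
      by (rule iffD1[OF zero, rotated]) (intro a_closed p'(1))
    with p'(1) have "p' \<in> I" by (rule three[OF I.is_ideal])
    then show "p = \<zero>\<^bsub>?Q\<^esub>" unfolding p'(2) by (rule iffD2[OF zero[OF p'(1)]])
  qed (use c z xy in simp_all)
  then have "?h (comm R (comm R (x \<otimes> left_comm R zs \<otimes> y) a) b) = \<zero>\<^bsub>?Q\<^esub>"
    using c z xy \<open>ws \<noteq> []\<close> by (simp add: comm_h zs_eq left_comm_snoc)
  then show ?thesis
    using zero[of "comm R (comm R (x \<otimes> left_comm R zs \<otimes> y) a) b"] c z xy \<open>ws \<noteq> []\<close>
    unfolding I_def[symmetric] by (simp add: zs_eq left_comm_snoc)
qed

lemma comm_twice_T_ideal:
  assumes three: "\<And>x I. \<lbrakk>ideal I R; x \<in> carrier R; x \<oplus> x \<oplus> x \<in> I\<rbrakk> \<Longrightarrow> x \<in> I"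
    and m: "m > 0"
    and u: "u \<in> T_ideal R m" and ab: "a \<in> carrier R" "b \<in> carrier R"
  shows "comm R (comm R u a) b \<in> T_ideal R (m + 2)"
proof (cases "m = 1")
  case True
  then have "left_comm R [u, a, b] \<in> T_ideal R (m + 2)"
    using u ab by (intro left_comm_in_T_ideal) (auto simp: T_ideal_def)
  then show ?thesis by (simp add: left_comm_def)
next
  case False
  let ?J = "{u \<in> carrier R. \<forall>x\<in>carrier R. \<forall>y\<in>carrier R. \<forall>a\<in>carrier R. \<forall>b\<in>carrier R.
    comm R (comm R (x \<otimes> u \<otimes> y) a) b \<in> T_ideal R (m + 2)}"
  have "T_ideal R m \<subseteq> ?J"
  proof (rule T_ideal_minimal[OF ideal_sandwich_comm_twice[OF T_ideal_is_ideal]])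
    show "m > 1" using m False by linarith
    fix xs assume len: "length xs = m" and xs: "set xs \<subseteq> carrier R"
    have two: "length xs \<ge> 2" using len \<open>m > 1\<close> by linarith
    then have "left_comm R xs \<in> carrier R" using xs by (intro left_comm_closed) auto
    then show "left_comm R xs \<in> ?J"
      using sandwich_left_comm_comm_twice[OF three xs two, unfolded len] by simp
  qed
  then have "u \<in> ?J" using u by (rule subsetD)
  then have u_closed: "u \<in> carrier R"
    and J: "\<forall>x\<in>carrier R. \<forall>y\<in>carrier R. \<forall>a\<in>carrier R. \<forall>b\<in>carrier R.
      comm R (comm R (x \<otimes> u \<otimes> y) a) b \<in> T_ideal R (m + 2)"
    by simp_all
  have "comm R (comm R (\<one> \<otimes> u \<otimes> \<one>) a) b \<in> T_ideal R (m + 2)"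
    by (rule J[rule_format, OF one_closed one_closed ab])
  with u_closed show ?thesis by simp
qed

end

section \<open>Scalars and spans\<close>

context assoc_algebra
begin

lemma ideal_smult_closed:
  assumes "ideal I A" "r \<in> carrier R" "x \<in> I"
  shows "r \<odot>\<^bsub>A\<^esub> x \<in> I"
proof -
  interpret I: ideal I A by fact
  have x: "x \<in> carrier A" using assms(3) by (rule I.Icarr)
  then have "r \<odot>\<^bsub>A\<^esub> x = (r \<odot>\<^bsub>A\<^esub> \<one>\<^bsub>A\<^esub>) \<otimes>\<^bsub>A\<^esub> x"
    using assms(2) by (simp add: smult_mult_left)
  then show ?thesis using assms x by (simp add: I.I_l_closed)
qed

text \<open>Ideals are closed under scalars because \<open>r x = (r 1) x\<close>, so one may divide by 3 inside them.\<close>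
lemma ideal_three_cancel:
  assumes three: "\<one>\<^bsub>R\<^esub> \<oplus>\<^bsub>R\<^esub> \<one>\<^bsub>R\<^esub> \<oplus>\<^bsub>R\<^esub> \<one>\<^bsub>R\<^esub> \<in> Units R"
    and I: "ideal I A" and x: "x \<in> carrier A" "x \<oplus>\<^bsub>A\<^esub> x \<oplus>\<^bsub>A\<^esub> x \<in> I"
  shows "x \<in> I"
proof -
  let ?t = "\<one>\<^bsub>R\<^esub> \<oplus>\<^bsub>R\<^esub> \<one>\<^bsub>R\<^esub> \<oplus>\<^bsub>R\<^esub> \<one>\<^bsub>R\<^esub>"
  have inv: "inv\<^bsub>R\<^esub> ?t \<in> carrier R" "inv\<^bsub>R\<^esub> ?t \<otimes>\<^bsub>R\<^esub> ?t = \<one>\<^bsub>R\<^esub>"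
    using three by (simp_all add: R.Units_inv_closed R.Units_l_inv)
  have "x = (inv\<^bsub>R\<^esub> ?t \<otimes>\<^bsub>R\<^esub> ?t) \<odot>\<^bsub>A\<^esub> x" using x inv by simp
  also have "\<dots> = inv\<^bsub>R\<^esub> ?t \<odot>\<^bsub>A\<^esub> (?t \<odot>\<^bsub>A\<^esub> x)"
    using x inv by (intro smult_assoc1) simp_all
  also have "?t \<odot>\<^bsub>A\<^esub> x = x \<oplus>\<^bsub>A\<^esub> x \<oplus>\<^bsub>A\<^esub> x"
    using x by (simp add: smult_l_distr)
  finally show ?thesis using ideal_smult_closed[OF I inv(1) x(2)] by simp
qed

lemma ideal_is_submodule:
  assumes "ideal I A"
  shows "submodule I R A"
proof -
  interpret I: ideal I A by fact
  show ?thesis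
    by (intro submodule.intro submodule_axioms.intro I.a_subgroup ideal_smult_closed assms)
qed

lemma lin_span_subset_ideal:
  assumes "ideal I A" "S \<subseteq> I"
  shows "lin_span R A S \<subseteq> I"
  using assms ideal_is_submodule by (auto simp: lin_span_def)

lemma lin_span_self: "S \<subseteq> lin_span R A S"
  by (auto simp: lin_span_def)

end

theorem proposition1p3:
  fixes R :: "('r, 'x) ring_scheme" and A :: "('r, 'a, 'y) module_scheme" and n :: nat
  assumes "assoc_algebra R A"
    and "\<one>\<^bsub>R\<^esub> \<oplus>\<^bsub>R\<^esub> \<one>\<^bsub>R\<^esub> \<oplus>\<^bsub>R\<^esub> \<one>\<^bsub>R\<^esub> \<in> Units R"
    and "n > 2"
  shows "Idl\<^bsub>A\<^esub> (comm_span R A (T_ideal A (n - 2))) = T_ideal A n"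
proof -
  interpret assoc_algebra R A by fact
  let ?G = "{left_comm A [u, a, b] | u a b. u \<in> T_ideal A (n - 2) \<and> a \<in> carrier A \<and> b \<in> carrier A}"
  have n: "n - 2 + 2 = n" "n - 2 > 0" using assms(3) by auto
  have "?G \<subseteq> T_ideal A n"
    using A.comm_twice_T_ideal[OF ideal_three_cancel[OF assms(2)], of "n - 2"] n
    by (auto simp: left_comm_def)
  then have span: "comm_span R A (T_ideal A (n - 2)) \<subseteq> T_ideal A n"
    unfolding comm_span_def by (intro lin_span_subset_ideal A.T_ideal_is_ideal)
  interpret Tn: ideal "T_ideal A n" A by (rule A.T_ideal_is_ideal)
  have carrier: "comm_span R A (T_ideal A (n - 2)) \<subseteq> carrier A"
    using span Tn.a_subset by blast
  show ?thesis
  proof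
    show "Idl\<^bsub>A\<^esub> (comm_span R A (T_ideal A (n - 2))) \<subseteq> T_ideal A n"
      by (rule A.genideal_minimal[OF A.T_ideal_is_ideal span])
    have "left_comm A xs \<in> Idl\<^bsub>A\<^esub> (comm_span R A (T_ideal A (n - 2)))"
      if xs: "length xs = n" "set xs \<subseteq> carrier A" for xs
    proof -
      obtain ys b where ys: "xs = ys @ [b]"
        using xs(1) n by (cases xs rule: rev_cases) auto
      obtain ws a where ws: "ys = ws @ [a]"
        using xs(1) ys n by (cases ys rule: rev_cases) auto
      have "ws \<noteq> []" using xs(1) ys ws assms(3) by auto
      then have "left_comm A xs = left_comm A [left_comm A ws, a, b]"
        by (simp add: ys ws left_comm_def)
      moreover have "left_comm A ws \<in> T_ideal A (n - 2)"
        using xs ys ws n(2) by (intro A.left_comm_in_T_ideal) auto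
      moreover have "a \<in> carrier A" "b \<in> carrier A"
        using xs(2) ys ws by auto
      ultimately have "left_comm A xs \<in> ?G" by blast
      then have "left_comm A xs \<in> comm_span R A (T_ideal A (n - 2))"
        unfolding comm_span_def by (rule subsetD[OF lin_span_self])
      then show ?thesis by (rule subsetD[OF A.genideal_self[OF carrier]])
    qed
    then show "T_ideal A n \<subseteq> Idl\<^bsub>A\<^esub> (comm_span R A (T_ideal A (n - 2)))"
      using assms(3) by (intro A.T_ideal_minimal A.genideal_ideal[OF carrier]) simp_all
  qed
qed

end
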